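(* Let $b=\lambda+i\eta$ with $\lambda>0$ and $\eta\in\mathbb{R}$, let $\mathcal{P}_n(b;x)$ be the $n$-th complementary Romanovski-Routh polynomial, and for $\lambda\neq1$ put $\mathfrak{M}_n=\mathfrak{M}_n(b)=\dfrac{\eta(n+\lambda)}{\lambda(\lambda-1)}$. If $\lambda>1$, then: (1) if $\eta=0$, the negative zeros of $\mathcal{P}_n(b;x)$ are concave and the positive zeros of $\mathcal{P}_n(b;x)$ are convex; (2) if $\eta>0$, the negative zeros of $\mathcal{P}_n(b;x)$ are concave and the positive zeros of the polynomial $x\mapsto\mathcal{P}_n(b;x+\mathfrak{M}_n)$ are convex; (3) if $\eta<0$, the negative zeros of $x\mapsto\mathcal{P}_n(b;x+\mathfrak{M}_n)$ are concave and the positive zeros of $\mathcal{P}_n(b;x)$ are convex. If $0<\lambda<1$, then: (4) if $\eta>0$, the zeros of $\mathcal{P}_n(b;x)$ in $(\mathfrak{M}_n,0)$ are concave; (5) if $\eta<0$, the zeros of $\mathcal{P}_n(b;x)$ in $(0,\mathfrak{M}_n)$ are convex. If $\lambda=1$: when $\eta>0$ all negative zeros of $\mathcal{P}_n(b;x)$ are concave, and when $\eta<0$ all positive zeros of $\mathcal{P}_n(b;x)$ are convex.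
   Context: For $b=\lambda+i\eta$ with $\lambda>0$, $\eta\in\mathbb{R}$, the complementary Romanovski-Routh (CRR) polynomials are $\mathcal{P}_n(b;x)=\frac{(2\lambda)_n}{2^n(\lambda)_n}(x-i)^n\,{}_2F_1\!\left(-n,b;b+\overline{b};\frac{-2i}{x-i}\right)$, $n\ge0$, where $(\alpha)_n=\alpha(\alpha+1)\cdots(\alpha+n-1)$. Equivalently, $\mathcal{P}_0(b;x)=1$, $\mathcal{P}_1(b;x)=x-c_1^{(b)}$, and $\mathcal{P}_{n+1}(b;x)=(x-c_{n+1}^{(b)})\mathcal{P}_n(b;x)-d_{n+1}^{(\lambda)}(x^2+1)\mathcal{P}_{n-1}(b;x)$ for $n\ge1$, where $c_n^{(b)}=\frac{\eta}{\lambda+n-1}$ and $d_{n+1}^{(\lambda)}=\frac14\frac{n(n+2\lambda-1)}{(n+\lambda-1)(n+\lambda)}$, $n\ge1$. It is known that $\mathcal{P}_n(b;x)$ has $n$ real simple zeros. Let $x_1<\cdots<x_m$ be all the zeros of a function lying in a given interval. These zeros are called convex (on that interval) if $x_k-x_{k-1}<x_{k+1}-x_k$ for each $k=2,\ldots,m-1$, and concave if $x_k-x_{k-1}>x_{k+1}-x_k$ for each $k=2,\ldots,m-1$. "Negative zeros" and "positive zeros" refer to the intervals $(-\infty,0)$ and $(0,\infty)$. *)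

theory Defs
  imports "HOL-Analysis.Analysis"
begin

(* The series terminates because of the upper parameter -n, so eval_fps is a finite sum.
   The definition is only used at real x, where x - i is nonzero. *)
definition crr :: "complex \<Rightarrow> nat \<Rightarrow> real \<Rightarrow> complex" where
  "crr b n x =
     pochhammer (2 * of_real (Re b)) n / (2 ^ n * pochhammer (of_real (Re b)) n)
     * (of_real x - \<i>) ^ n
     * eval_fps (fps_hypergeo [- of_nat n, b] [b + cnj b] 1) (- 2 * \<i> / (of_real x - \<i>))"

definition crr_shift :: "complex \<Rightarrow> nat \<Rightarrow> real" where
  "crr_shift b n = Im b * (real n + Re b) / (Re b * (Re b - 1))"

(* In both definitions the increasing enumeration x 1 < ... < x m lists all zeros of f in I;
   it is unique, and its existence makes the set of zeros in I finite. *)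
definition convex_zeros_on :: "real set \<Rightarrow> (real \<Rightarrow> 'a::zero) \<Rightarrow> bool" where
  "convex_zeros_on I f \<longleftrightarrow>
     (\<exists>m (x :: nat \<Rightarrow> real). strict_mono_on {1..m} x \<and> x ` {1..m} = {t \<in> I. f t = 0} \<and>
        (\<forall>k\<in>{2..<m}. x k - x (k - 1) < x (k + 1) - x k))"

definition concave_zeros_on :: "real set \<Rightarrow> (real \<Rightarrow> 'a::zero) \<Rightarrow> bool" where
  "concave_zeros_on I f \<longleftrightarrow>
     (\<exists>m (x :: nat \<Rightarrow> real). strict_mono_on {1..m} x \<and> x ` {1..m} = {t \<in> I. f t = 0} \<and>
        (\<forall>k\<in>{2..<m}. x k - x (k - 1) > x (k + 1) - x k))"

lemma of_real_minus_ii_nonzero: "complex_of_real x - \<i> \<noteq> 0"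
  by (simp add: complex_eq_iff)

lemma pochhammer_minus_nat_eq_0: "n < k \<Longrightarrow> pochhammer (- of_nat n :: complex) k = 0"
  by (simp add: pochhammer_of_nat_eq_0_iff)

lemma eval_hypergeo_sums:
  "(\<lambda>k. pochhammer (- of_nat n) k * pochhammer b k / (pochhammer c k * fact k) * t ^ k) sums
     eval_fps (fps_hypergeo [- of_nat n, b] [c] 1) (t :: complex)"
proof -
  have "(\<lambda>k. pochhammer (- of_nat n) k * pochhammer b k / (pochhammer c k * fact k) * t ^ k) sums
    (\<Sum>k\<le>n. pochhammer (- of_nat n) k * pochhammer b k / (pochhammer c k * fact k) * t ^ k)"
    by (rule sums_finite) (auto simp: pochhammer_minus_nat_eq_0)
  thus ?thesis
    unfolding eval_fps_def by (simp add: sums_iff)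
qed

lemma hypergeo_contiguous:
  fixes b c t :: complex
  assumes c: "\<And>k. c + of_nat k \<noteq> 0" and n: "n > 0"
  defines "F \<equiv> \<lambda>n. eval_fps (fps_hypergeo [- of_nat n, b] [c] 1) t"
  shows "(c + of_nat n) * F (n + 1) =
           (2 * of_nat n + c - (b + of_nat n) * t) * F n - of_nat n * (1 - t) * F (n - 1)"
proof -
  define A where "A = (\<lambda>n k. pochhammer (- of_nat n) k * pochhammer b k / (pochhammer c k * fact k))"
  define B where "B = (\<lambda>n k. case k of 0 \<Rightarrow> 0 | Suc j \<Rightarrow> A n j)"
  have A: "(\<lambda>k. A n k * t ^ k) sums F n" for n
    unfolding A_def F_def by (rule eval_hypergeo_sums)
  have B: "(\<lambda>k. B n k * t ^ k) sums (t * F n)" for n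
  proof -
    have "(\<lambda>k. B n (Suc k) * t ^ Suc k) sums (t * F n)"
      using sums_mult[OF A, of t n] by (simp add: B_def mult_ac)
    from sums_Suc[OF this] show ?thesis by (simp add: B_def)
  qed
  obtain m where m: "n = Suc m" using n by (cases n) auto
  have pc: "pochhammer c k \<noteq> 0" for k
    using c by (metis pochhammer_eq_0_iff add.left_inverse)
  have coeff: "(c + of_nat n) * A (n + 1) k =
      (2 * of_nat n + c) * A n k - (b + of_nat n) * B n k - of_nat n * A m k + of_nat n * B m k" for k
  proof -
    consider "k = 0" | "k = 1" | j where "k = Suc (Suc j)"
      by (metis One_nat_def not0_implies_Suc)
    thus ?thesis
    proof cases
      case 1
      thus ?thesis by (simp add: A_def B_def)
    next
      case 2
      thus ?thesis using c[of 0] by (simp add: A_def B_def m field_simps)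
    next
      case (3 j)
      define s :: complex where "s = of_nat m"
      define u :: complex where "u = of_nat j"
      define R where "R = pochhammer (- s) j"
      define Q where "Q = pochhammer b j"
      define P where "P = pochhammer c j"
      define f :: complex where "f = fact j"
      have nz: "P \<noteq> 0" "c + u \<noteq> 0" "c + u + 1 \<noteq> 0" "u + 1 \<noteq> 0" "u + 2 \<noteq> 0" "f \<noteq> 0"
        using c[of j] c[of "Suc j"] pc[of j] of_nat_neq_0[of j, where 'a = complex]
              of_nat_neq_0[of "Suc j", where 'a = complex]
        by (simp_all add: P_def u_def f_def add_ac)
      have e0: "pochhammer (- of_nat m) (Suc (Suc j)) = R * (u - s) * (u + 1 - s)"
               "pochhammer (- of_nat m) (Suc j) = R * (u - s)"
        by (simp_all add: pochhammer_Suc R_def s_def u_def algebra_simps)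
      have s1: "- of_nat n + 1 = - s" "- of_nat (n + 1) + 1 = (- of_nat n :: complex)" "of_nat n = s + 1"
        by simp_all (simp_all add: m s_def)
      have e1': "pochhammer (- of_nat n) (Suc i) = - (s + 1) * pochhammer (- s) i" for i
        by (simp add: pochhammer_rec s1(1) del: of_nat_Suc) (simp add: s1(3) algebra_simps)
      have e1: "pochhammer (- of_nat n) (Suc (Suc j)) = - (s + 1) * R * (u - s)"
               "pochhammer (- of_nat n) (Suc j) = - (s + 1) * R"
        unfolding e1' using e0(2) by (simp_all add: R_def s_def)
      have e2: "pochhammer (- of_nat (n + 1)) (Suc (Suc j)) = (s + 2) * (s + 1) * R"
        unfolding pochhammer_rec[of "- of_nat (n + 1)" "Suc j"] s1(2) e1(2)
        by (simp add: m s_def algebra_simps)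
      have e3: "pochhammer b (Suc (Suc j)) = Q * (b + u) * (b + u + 1)"
               "pochhammer b (Suc j) = Q * (b + u)"
               "pochhammer c (Suc (Suc j)) = P * (c + u) * (c + u + 1)"
               "pochhammer c (Suc j) = P * (c + u)"
               "fact (Suc j) = (u + 1) * f" "fact (Suc (Suc j)) = (u + 2) * (u + 1) * f"
        by (simp_all add: pochhammer_Suc Q_def P_def u_def f_def algebra_simps)
      have AA: "A (n + 1) (Suc (Suc j)) = (s + 2) * (s + 1) * R * (Q * (b + u) * (b + u + 1))
                  / (P * (c + u) * (c + u + 1) * ((u + 2) * (u + 1) * f))"
        "A n (Suc (Suc j)) = - (s + 1) * R * (u - s) * (Q * (b + u) * (b + u + 1))
                  / (P * (c + u) * (c + u + 1) * ((u + 2) * (u + 1) * f))"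
        "A m (Suc (Suc j)) = R * (u - s) * (u + 1 - s) * (Q * (b + u) * (b + u + 1))
                  / (P * (c + u) * (c + u + 1) * ((u + 2) * (u + 1) * f))"
        "A n (Suc j) = - (s + 1) * R * (Q * (b + u)) / (P * (c + u) * ((u + 1) * f))"
        "A m (Suc j) = R * (u - s) * (Q * (b + u)) / (P * (c + u) * ((u + 1) * f))"
        unfolding A_def e0 e1 e2 e3 by simp_all
      define E where "E = P * (c + u) * (c + u + 1) * ((u + 2) * (u + 1) * f)"
      define D where "D = R * Q * (b + u) * (s + 1) / E"
      have E: "z / (P * (c + u) * ((u + 1) * f)) = z * ((c + u + 1) * (u + 2)) / E" for z
        unfolding E_def using nz by (simp add: frac_eq_eq)
      have AD: "A (n + 1) (Suc (Suc j)) = D * ((s + 2) * (b + u + 1))"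
        "A n (Suc (Suc j)) = D * (- (u - s) * (b + u + 1))"
        "(s + 1) * A m (Suc (Suc j)) = D * ((u - s) * (u + 1 - s) * (b + u + 1))"
        "A n (Suc j) = D * (- (c + u + 1) * (u + 2))"
        "(s + 1) * A m (Suc j) = D * ((u - s) * (c + u + 1) * (u + 2))"
        unfolding AA E unfolding D_def E_def[symmetric] times_divide_eq_left times_divide_eq_right
        by (simp_all only: mult_ac mult_minus_left mult_minus_right)
      have id: "(c + (s + 1)) * ((s + 2) * (b + u + 1)) =
          (2 * (s + 1) + c) * (- (u - s) * (b + u + 1)) - (b + (s + 1)) * (- (c + u + 1) * (u + 2))
          - (u - s) * (u + 1 - s) * (b + u + 1) + (u - s) * (c + u + 1) * (u + 2)"
        by algebra
      have "(c + of_nat n) * A (n + 1) k - ((2 * of_nat n + c) * A n k - (b + of_nat n) * B n k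
               - of_nat n * A m k + of_nat n * B m k) =
            D * ((c + (s + 1)) * ((s + 2) * (b + u + 1)) -
          ((2 * (s + 1) + c) * (- (u - s) * (b + u + 1)) - (b + (s + 1)) * (- (c + u + 1) * (u + 2))
          - (u - s) * (u + 1 - s) * (b + u + 1) + (u - s) * (c + u + 1) * (u + 2)))"
        unfolding 3 B_def nat.case s1(3) AD
        by algebra
      also have "\<dots> = 0"
        unfolding id by simp
      finally show ?thesis by simp
    qed
  qed
  have s1: "(\<lambda>k. (c + of_nat n) * (A (n + 1) k * t ^ k)) sums ((c + of_nat n) * F (n + 1))"
    by (intro sums_mult A)
  have s2: "(\<lambda>k. (2 * of_nat n + c) * (A n k * t ^ k) - (b + of_nat n) * (B n k * t ^ k)
      - of_nat n * (A m k * t ^ k) + of_nat n * (B m k * t ^ k)) sums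
      ((2 * of_nat n + c) * F n - (b + of_nat n) * (t * F n)
      - of_nat n * F m + of_nat n * (t * F m))"
    by (intro sums_add sums_diff sums_mult A B)
  have eq: "(\<lambda>k. (c + of_nat n) * (A (n + 1) k * t ^ k)) =
     (\<lambda>k. (2 * of_nat n + c) * (A n k * t ^ k) - (b + of_nat n) * (B n k * t ^ k)
      - of_nat n * (A m k * t ^ k) + of_nat n * (B m k * t ^ k))"
  proof
    fix k
    show "(c + of_nat n) * (A (n + 1) k * t ^ k) =
     (2 * of_nat n + c) * (A n k * t ^ k) - (b + of_nat n) * (B n k * t ^ k)
      - of_nat n * (A m k * t ^ k) + of_nat n * (B m k * t ^ k)"
      using arg_cong[OF coeff[of k], of "\<lambda>y. y * t ^ k"] by (simp add: algebra_simps)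
  qed
  have "(c + of_nat n) * F (n + 1) = (2 * of_nat n + c) * F n - (b + of_nat n) * (t * F n)
      - of_nat n * F m + of_nat n * (t * F m)"
    by (rule sums_unique2[OF s1[unfolded eq] s2])
  thus ?thesis by (simp add: m algebra_simps)
qed

lemma crr_0: "crr b 0 x = 1"
  using sums_unique2[OF eval_hypergeo_sums[of 0 b "b + cnj b"] sums_finite[of "{0}"]]
  by (simp add: crr_def pochhammer_0_left)

lemma crr_1:
  assumes "Re b > 0"
  shows "crr b 1 x = of_real (x - Im b / Re b)"
proof -
  have bb: "b + cnj b = 2 * of_real (Re b)" "of_real (Re b) \<noteq> (0 :: complex)"
    using assms by (simp_all add: complex_eq_iff)
  define w where "w = of_real x - \<i>"
  have w: "w \<noteq> 0" unfolding w_def by (rule of_real_minus_ii_nonzero)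
  have "(\<lambda>k. pochhammer (- of_nat 1) k * pochhammer b k / (pochhammer (b + cnj b) k * fact k)
           * (- 2 * \<i> / w) ^ k) sums
        (\<Sum>k\<in>{0, 1}. pochhammer (- of_nat 1) k * pochhammer b k / (pochhammer (b + cnj b) k * fact k)
           * (- 2 * \<i> / w) ^ k)"
    by (rule sums_finite) (use pochhammer_minus_nat_eq_0[of 1] in auto)
  from sums_unique2[OF eval_hypergeo_sums this]
  have "crr b 1 x = w * (1 + b / (2 * of_real (Re b)) * (2 * \<i> / w))"
    unfolding crr_def w_def[symmetric] using bb by (simp add: bb(1))
  also have "\<dots> = w + \<i> * b / of_real (Re b)"
    using w bb(2) by (simp add: field_simps)
  also have "\<dots> = of_real (x - Im b / Re b)"
    using assms by (simp add: w_def complex_eq_iff Re_divide Im_divide power2_eq_square)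
  finally show ?thesis .
qed

lemma crr_rec:
  fixes b :: complex and n :: nat and l :: real
  assumes lam: "Re b > 0" and n: "n > 0"
  defines "l \<equiv> Re b"
  shows "crr b (n + 1) x = of_real (x - Im b / (l + n)) * crr b n x
     - of_real (1 / 4 * (n * (n + 2 * l - 1)) / ((n + l - 1) * (n + l)) * (x\<^sup>2 + 1)) * crr b (n - 1) x"
proof -
  obtain m where m: "n = Suc m" using n by (cases n) auto
  define L s w t :: complex where "L = of_real l" and "s = of_nat n" and "w = of_real x - \<i>"
    and "t = - 2 * \<i> / w"
  define K where "K = (\<lambda>n. pochhammer (2 * L) n / (2 ^ n * pochhammer L n))"
  define F where "F = (\<lambda>n. eval_fps (fps_hypergeo [- of_nat n, b] [2 * L] 1) t)"
  have l: "l > 0" using lam by (simp add: l_def)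
  have bc: "b + cnj b = 2 * L" by (simp add: L_def l_def complex_eq_iff)
  have w: "w \<noteq> 0" unfolding w_def by (rule of_real_minus_ii_nonzero)
  have crr: "crr b k x = K k * w ^ k * F k" for k
    by (simp add: crr_def bc K_def F_def L_def l_def w_def t_def)
  have nz2: "2 * L + of_nat k \<noteq> 0" and nz: "L + of_nat k \<noteq> 0" for k
    using l by (simp_all add: L_def complex_eq_iff add_pos_nonneg less_imp_neq[symmetric])
  have Ln: "L + s \<noteq> 0" "L + s - 1 \<noteq> 0" "2 * L + s \<noteq> 0"
    using nz[of n] nz[of m] nz2[of n] by (simp_all add: s_def m add_ac)
  have K1: "K (Suc k) = K k * (2 * L + of_nat k) / (2 * (L + of_nat k))" for k
    by (simp add: K_def pochhammer_Suc)
  have Kn: "K (n + 1) = K n * (2 * L + s) / (2 * (L + s))"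
    using K1[of n] by (simp add: s_def)
  have Km: "K n = K m * (2 * L + s - 1) / (2 * (L + s - 1))"
    using K1[of m] by (simp add: s_def m algebra_simps)
  have F: "(2 * L + s) * F (n + 1) = (2 * s + 2 * L - (b + s) * t) * F n - s * (1 - t) * F m"
    using hypergeo_contiguous[OF nz2 n, of b t] by (simp add: F_def s_def m)
  have b: "b = L + \<i> * of_real (Im b)"
    by (simp add: L_def l_def complex_eq_iff)
  have wt: "w * t = - 2 * \<i>" using w by (simp add: t_def)
  have wsq: "w * (w - w * t) = of_real (x\<^sup>2 + 1)"
    unfolding wt by (simp add: w_def complex_eq_iff power2_eq_square)
  have lin: "w * (2 * s + 2 * L - (b + s) * t) / (2 * (L + s)) = of_real (x - Im b / (l + n))"
  proof -
    have "w * (2 * s + 2 * L - (b + s) * t) = 2 * w * (L + s) - (b + s) * (w * t)"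
      by (simp add: algebra_simps)
    also have "\<dots> = 2 * (w * (L + s) + \<i> * (b + s))"
      unfolding wt by (simp add: algebra_simps)
    also have "\<dots> = 2 * (of_real x * (L + s) - of_real (Im b))"
      by (subst b) (simp add: w_def algebra_simps)
    finally have "w * (2 * s + 2 * L - (b + s) * t) / (2 * (L + s)) =
        (of_real x * (L + s) - of_real (Im b)) / (L + s)"
      by (simp only: mult_divide_mult_cancel_left_if) simp
    also have "\<dots> = of_real x - of_real (Im b) / (L + s)"
      using Ln(1) by (simp add: diff_divide_distrib)
    finally show ?thesis
      by (simp add: L_def s_def)
  qed
  have "crr b (n + 1) x = K n * w ^ n * (w * ((2 * L + s) * F (n + 1)) / (2 * (L + s)))"
    unfolding crr Kn by simp
  also have "\<dots> = (w * (2 * s + 2 * L - (b + s) * t) / (2 * (L + s))) * (K n * w ^ n * F n)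
      - (K n * w ^ n * (w * (1 - t)) * s / (2 * (L + s))) * F m"
    unfolding F divide_inverse by (simp only: algebra_simps)
  also have "K n * w ^ n * (w * (1 - t)) * s / (2 * (L + s)) =
      (w * (w - w * t)) * (s * (2 * L + s - 1) / (4 * (L + s - 1) * (L + s))) * (K m * w ^ m)"
    unfolding Km by (simp add: m algebra_simps)
  also have "w * (w - w * t) * (s * (2 * L + s - 1) / (4 * (L + s - 1) * (L + s))) =
      of_real (1 / 4 * (n * (n + 2 * l - 1)) / ((n + l - 1) * (n + l)) * (x\<^sup>2 + 1))"
  proof -
    have "1 / 4 * (n * (n + 2 * l - 1)) / ((n + l - 1) * (n + l)) * (x\<^sup>2 + 1) =
        (x\<^sup>2 + 1) * (n * (2 * l + n - 1) / (4 * ((l + n - 1) * (l + n))))"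
      by (simp add: add.commute mult_ac)
    thus ?thesis
      unfolding wsq by (simp only: L_def s_def of_real_mult of_real_divide of_real_add of_real_diff
        of_real_of_nat_eq of_real_numeral of_real_1 mult.assoc)
  qed
  finally show ?thesis
    unfolding lin crr by (simp add: m)
qed

lemma crr_real:
  assumes "Re b > 0"
  shows "crr b n x \<in> \<real>"
proof (induction n rule: less_induct)
  case (less n)
  consider "n = 0" | "n = 1" | k where "n = k + 1" "k > 0"
    by (metis Suc_eq_plus1 One_nat_def not0_implies_Suc gr0I)
  thus ?case
  proof cases
    case 3
    show ?thesis unfolding 3 crr_rec[OF assms 3(2)]
      using less 3 by (intro Reals_diff Reals_mult Reals_of_real) auto
  qed (use crr_1[OF assms, of x] in \<open>simp_all add: crr_0\<close>)
qed

end

theory Submission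
  imports Defs
begin

text \<open>
  The spacing of the zeros is read off from a differential equation in normal form. Write
  \<open>\<lambda> = Re b\<close> and \<open>\<eta> = Im b\<close>. The polynomials form an Appell-type sequence: the derivative of
  the polynomial of degree \<open>n + 1\<close> is a constant times the polynomial of degree \<open>n\<close>
  (\<open>pderiv_crr_poly\<close>). Hence the three-term recurrence, in which \<open>x\<^sup>2 + 1\<close> multiplies the lowest
  term, is itself a second-order differential equation (\<open>crr_poly_ode\<close>). Multiplication by a
  positive weight, which does not move the zeros, removes the first-order term and gives
  \<open>u'' = - Q u\<close> with
  \<open>Q x = (- \<lambda> (\<lambda> - 1) x\<^sup>2 + 2 \<eta> (n + \<lambda>) x + const) / (1 + x\<^sup>2)\<^sup>2\<close> (\<open>crr_liouville_form\<close>).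

  Sturm's convexity theorem says that the gaps between consecutive zeros of \<open>u\<close> increase where
  \<open>Q\<close> decreases, and decrease where \<open>Q\<close> increases. Here \<open>Q\<close> need not be monotone on the
  intervals in question: on the unbounded ones it is negative far out and tends to \<open>0\<close>. Only the
  positive part of \<open>Q\<close> is monotone, and \<open>zero_gaps_increase\<close> is therefore stated under the
  hypothesis that \<open>Q t < Q s\<close> for those \<open>s < t\<close> with \<open>Q t > 0\<close>. This hypothesis follows when the numerator of
  \<open>Q\<close> weakly decreases and \<open>\<bar>x\<bar>\<close> strictly increases, for then the denominator increases too
  (\<open>crr_potential_less\<close>).

  The numerator is a parabola with vertex \<open>\<eta> (n + \<lambda>) / (\<lambda> (\<lambda> - 1))\<close>, which is \<open>crr_shift b n\<close>; it
  opens downwards for \<open>\<lambda> > 1\<close> and upwards for \<open>\<lambda> < 1\<close>, and it degenerates to a line for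
  \<open>\<lambda> = 1\<close>. Each interval in the theorem lies on one side of this vertex and on one side of the
  origin, so that numerator and denominator move in opposite directions.
\<close>

section \<open>Sturm's convexity theorem\<close>

lemma constant_sign_between:
  fixes u :: "real \<Rightarrow> real"
  assumes cont: "continuous_on {a<..<b} u" and nz: "\<And>t. a < t \<Longrightarrow> t < b \<Longrightarrow> u t \<noteq> 0"
  obtains \<sigma> where "\<And>t. a < t \<Longrightarrow> t < b \<Longrightarrow> \<sigma> * u t > 0"
proof (cases "a < b")
  case True
  define m where "m = (a + b) / 2"
  have m: "a < m" "m < b" using True by (simp_all add: m_def)
  have conn: "connected (u ` {a<..<b})"
    by (rule connected_continuous_image[OF cont]) simp
  have "u m * u t > 0" if t: "a < t" "t < b" for t
  proof (rule ccontr)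
    assume "\<not> u m * u t > 0"
    hence "u m * u t < 0" using nz[OF m] nz[OF t] by (simp add: less_le)
    hence "(u m \<le> 0 \<and> 0 \<le> u t) \<or> (u t \<le> 0 \<and> 0 \<le> u m)"
      by (auto simp: mult_less_0_iff)
    moreover have "u m \<in> u ` {a<..<b}" "u t \<in> u ` {a<..<b}" using m t by auto
    ultimately have "0 \<in> u ` {a<..<b}" using connectedD_interval[OF conn] by blast
    thus False using nz by force
  qed
  thus ?thesis by (rule that)
qed (use that in force)

text \<open>Since \<open>(u u')' = u'\<^sup>2 - Q u\<^sup>2\<close> is nonnegative, \<open>u u'\<close> is monotone; it vanishes at both ends, hence
  throughout, and \<open>u\<^sup>2\<close> is constant.\<close>

lemma no_two_zeros_if_nonpos_potential:
  fixes u u' Q :: "real \<Rightarrow> real"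
  assumes u: "\<And>x. (u has_real_derivative u' x) (at x)"
    and u': "\<And>x. (u' has_real_derivative - (Q x * u x)) (at x)"
    and "b < c" "u b = 0" "u c = 0"
    and Q: "\<And>t. b \<le> t \<Longrightarrow> t \<le> c \<Longrightarrow> Q t \<le> 0"
    and t: "b \<le> t" "t \<le> c"
  shows "u t = 0"
proof -
  have D: "((\<lambda>x. u x * u' x) has_real_derivative (u' x)\<^sup>2 - Q x * (u x)\<^sup>2) (at x)" for x
    by (rule derivative_eq_intros u u' refl)+ (simp add: power2_eq_square algebra_simps)
  have nonneg: "(u' x)\<^sup>2 - Q x * (u x)\<^sup>2 \<ge> 0" if "b \<le> x" "x \<le> c" for x
    using mult_nonpos_nonneg[OF Q[OF that], of "(u x)\<^sup>2"] by (smt (verit) zero_le_power2)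
  have mono: "u x * u' x \<le> u y * u' y" if "b \<le> x" "x \<le> y" "y \<le> c" for x y
    using D nonneg that by (intro DERIV_nonneg_imp_nondecreasing[of x y "\<lambda>x. u x * u' x"]) force+
  have zero: "u x * u' x = 0" if "b \<le> x" "x \<le> c" for x
    using mono[of b x] mono[of x c] assms that by auto
  have D2: "((\<lambda>x. (u x)\<^sup>2) has_real_derivative 2 * (u x * u' x)) (at x)" for x
    by (rule derivative_eq_intros u refl)+ simp
  have "(u t)\<^sup>2 \<le> (u b)\<^sup>2"
    by (rule DERIV_nonpos_imp_nonincreasing[of b t "\<lambda>x. (u x)\<^sup>2"]) (use t D2 zero in force)+
  thus ?thesis using assms by simp
qed

text \<open>Compare \<open>u\<close> on the left of the middle zero \<open>b\<close> with its mirror image \<open>v t = u (2 b - t)\<close>, which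
  solves the equation with the smaller potential \<open>Q (2 b - t)\<close> and vanishes at \<open>d = 2 b - c\<close>. If the
  right gap were not longer than the left one, then \<open>d\<close> would lie in \<open>[a, b)\<close>. With signs chosen
  so that both functions are positive on \<open>(d, b)\<close>, their Wronskian would be nonnegative at \<open>d\<close>,
  strictly increasing, and zero at \<open>b\<close>. The hypothesis on \<open>Q\<close> says that the positive part of \<open>Q\<close>
  is decreasing, strictly so as long as it is positive.\<close>

lemma zero_gaps_increase:
  fixes u u' Q :: "real \<Rightarrow> real"
  assumes u: "\<And>x. (u has_real_derivative u' x) (at x)"
    and u': "\<And>x. (u' has_real_derivative - (Q x * u x)) (at x)"
    and ab: "a < b" and bc: "b < c" and zeros: "u a = 0" "u b = 0" "u c = 0"
    and nz1: "\<And>t. a < t \<Longrightarrow> t < b \<Longrightarrow> u t \<noteq> 0"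
    and nz2: "\<And>t. b < t \<Longrightarrow> t < c \<Longrightarrow> u t \<noteq> 0"
    and Q: "\<And>s t. a \<le> s \<Longrightarrow> s < t \<Longrightarrow> t \<le> c \<Longrightarrow> 0 < Q t \<Longrightarrow> Q t < Q s"
  shows "b - a < c - b"
proof (rule ccontr)
  assume "\<not> b - a < c - b"
  define d where "d = 2 * b - c"
  have d: "a \<le> d" "d < b" using \<open>\<not> b - a < c - b\<close> bc by (simp_all add: d_def)
  have cont: "continuous_on S u" for S
    using u DERIV_isCont continuous_at_imp_continuous_on by blast
  obtain \<sigma> where \<sigma>: "\<And>t. a < t \<Longrightarrow> t < b \<Longrightarrow> \<sigma> * u t > 0"
    using constant_sign_between[OF cont nz1] by blast
  obtain \<tau> where \<tau>: "\<And>t. b < t \<Longrightarrow> t < c \<Longrightarrow> \<tau> * u t > 0"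
    using constant_sign_between[OF cont nz2] by blast
  \<comment> \<open>Once \<open>Q\<close> is nonpositive it stays so, and then \<open>u\<close> could not vanish at both \<open>b\<close> and \<open>c\<close>.\<close>
  have Qpos: "Q t > 0" if t: "a \<le> t" "t < b" for t
  proof (rule ccontr)
    assume "\<not> Q t > 0"
    hence "Q s \<le> 0" if "b \<le> s" "s \<le> c" for s
      using Q[of t s] t that by linarith
    hence "u ((b + c) / 2) = 0"
      using no_two_zeros_if_nonpos_potential[OF u u' bc zeros(2,3), of "(b + c) / 2"] bc by simp
    thus False using nz2[of "(b + c) / 2"] bc by simp
  qed
  \<comment> \<open>The Wronskian \<open>u v' - u' v\<close> for the mirror image \<open>v\<close>, multiplied by the two signs.\<close>
  define W where "W = (\<lambda>t. \<sigma> * \<tau> * (- (u t * u' (2 * b - t)) - u' t * u (2 * b - t)))"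
  have refl_deriv: "((\<lambda>t. u (2 * b - t)) has_real_derivative - u' (2 * b - t)) (at t)"
    "((\<lambda>t. u' (2 * b - t)) has_real_derivative Q (2 * b - t) * u (2 * b - t)) (at t)" for t
  proof -
    have "((\<lambda>t. 2 * b - t) has_real_derivative - 1) (at t)"
      by (auto intro!: derivative_eq_intros)
    from DERIV_chain2[OF u this] DERIV_chain2[OF u' this]
    show "((\<lambda>t. u (2 * b - t)) has_real_derivative - u' (2 * b - t)) (at t)"
      "((\<lambda>t. u' (2 * b - t)) has_real_derivative Q (2 * b - t) * u (2 * b - t)) (at t)" by simp_all
  qed
  have DW: "(W has_real_derivative
      (Q t - Q (2 * b - t)) * ((\<sigma> * u t) * (\<tau> * u (2 * b - t)))) (at t)" for t
    unfolding W_def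
    by (rule derivative_eq_intros u u' refl_deriv refl)+ (simp add: algebra_simps)
  have pos: "(Q t - Q (2 * b - t)) * ((\<sigma> * u t) * (\<tau> * u (2 * b - t))) > 0"
    if t: "d < t" "t < b" for t
  proof (rule mult_pos_pos[OF _ mult_pos_pos])
    show "Q t - Q (2 * b - t) > 0"
      using Q[of t "2 * b - t"] Qpos[of t] t d by (force simp: d_def)
    show "\<sigma> * u t > 0" "\<tau> * u (2 * b - t) > 0"
      using \<sigma>[of t] \<tau>[of "2 * b - t"] t d by (simp_all add: d_def)
  qed
  have "W d < W b"
  proof (rule DERIV_pos_imp_increasing_open[OF d(2)])
    show "\<exists>y. (W has_real_derivative y) (at x) \<and> y > 0" if "d < x" "x < b" for x
      using DW pos that by blast
    show "continuous_on {d..b} W"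
      using DW DERIV_isCont continuous_at_imp_continuous_on by blast
  qed
  also have "W b = 0" by (simp add: W_def zeros)
  \<comment> \<open>As \<open>\<sigma> * u d\<close> is nonnegative, \<open>\<tau> * u\<close> would increase into its zero \<open>c\<close>, although it is
    positive to the left of \<open>c\<close>.\<close>
  finally have "(\<sigma> * u d) * (\<tau> * u' c) > 0"
    by (simp add: W_def d_def zeros algebra_simps)
  moreover have "\<sigma> * u d \<ge> 0"
    using \<sigma>[of d] d zeros by (cases "d = a") auto
  ultimately have "\<tau> * u' c > 0" by (simp add: zero_less_mult_iff)
  moreover have "((\<lambda>t. \<tau> * u t) has_real_derivative \<tau> * u' c) (at c)"
    by (rule DERIV_cmult[OF u])
  ultimately obtain e where e: "e > 0" "\<And>h. 0 < h \<Longrightarrow> h < e \<Longrightarrow> \<tau> * u (c - h) < \<tau> * u c"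
    using DERIV_pos_inc_left by blast
  define h where "h = min e (c - b) / 2"
  have "0 < h" "h < e" "h < c - b" using e(1) bc by (auto simp: h_def min_def)
  thus False using e(2)[of h] \<tau>[of "c - h"] zeros by simp
qed

lemma zero_gaps_decrease:
  fixes u u' Q :: "real \<Rightarrow> real"
  assumes u: "\<And>x. (u has_real_derivative u' x) (at x)"
    and u': "\<And>x. (u' has_real_derivative - (Q x * u x)) (at x)"
    and ab: "a < b" and bc: "b < c" and zeros: "u a = 0" "u b = 0" "u c = 0"
    and nz1: "\<And>t. a < t \<Longrightarrow> t < b \<Longrightarrow> u t \<noteq> 0"
    and nz2: "\<And>t. b < t \<Longrightarrow> t < c \<Longrightarrow> u t \<noteq> 0"
    and Q: "\<And>s t. a \<le> s \<Longrightarrow> s < t \<Longrightarrow> t \<le> c \<Longrightarrow> 0 < Q s \<Longrightarrow> Q s < Q t"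
  shows "c - b < b - a"
proof -
  have "- b - - c < - a - - b"
  proof (rule zero_gaps_increase[where u = "\<lambda>t. u (- t)" and u' = "\<lambda>t. - u' (- t)"
        and Q = "\<lambda>t. Q (- t)"])
    show "((\<lambda>t. u (- t)) has_real_derivative - u' (- x)) (at x)" for x
      using u[of "- x"] by (simp add: DERIV_mirror)
    show "((\<lambda>t. - u' (- t)) has_real_derivative - (Q (- x) * u (- x))) (at x)" for x
      using DERIV_minus[OF iffD1[OF DERIV_mirror u'[of "- x"]]] by simp
  qed (use assms in auto)
  thus ?thesis by simp
qed

text \<open>Reduces a condition on the increasing enumeration of a finite set to one on any three consecutive
  elements, which is how the gap lemmas speak.\<close>

lemma enumerate_with_consecutive_triples:
  fixes S :: "real set"
  assumes fin: "finite S"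
    and P: "\<And>a b c. a \<in> S \<Longrightarrow> b \<in> S \<Longrightarrow> c \<in> S \<Longrightarrow> a < b \<Longrightarrow> b < c \<Longrightarrow>
      S \<inter> {a<..<b} = {} \<Longrightarrow> S \<inter> {b<..<c} = {} \<Longrightarrow> P a b c"
  shows "\<exists>m (x :: nat \<Rightarrow> real). strict_mono_on {1..m} x \<and> x ` {1..m} = S \<and>
    (\<forall>k\<in>{2..<m}. P (x (k - 1)) (x k) (x (k + 1)))"
proof -
  define L where "L = sorted_list_of_set S"
  define x where "x = (\<lambda>k. L ! (k - 1))"
  have mono: "strict_mono_on {1..length L} x"
  proof (rule strict_mono_onI)
    fix i j assume "i \<in> {1..length L}" "j \<in> {1..length L}" "i < j"
    thus "x i < x j"
      unfolding x_def L_def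
      by (intro sorted_wrt_nth_less[OF strict_sorted_list_of_set]) auto
  qed
  have img: "x ` {1..length L} = S"
  proof -
    have "{..<length L} = (\<lambda>k. k - 1) ` {1..length L}"
    proof (intro equalityI subsetI)
      fix i assume "i \<in> {..<length L}"
      thus "i \<in> (\<lambda>k. k - 1) ` {1..length L}" by (intro image_eqI[of _ _ "Suc i"]) auto
    qed auto
    hence "x ` {1..length L} = (!) L ` {..<length L}"
      unfolding x_def by (simp add: image_image)
    also have "\<dots> = set L" by (auto simp: in_set_conv_nth)
    finally show ?thesis using fin by (simp add: L_def)
  qed
  have less: "x i < x j" if "i < j" "1 \<le> i" "j \<le> length L" for i j
    using strict_mono_onD[OF mono, of i j] that by simp
  have gap: "S \<inter> {x k<..<x (k + 1)} = {}" if k: "1 \<le> k" "k + 1 \<le> length L" for k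
  proof -
    have "\<not> (x k < x j \<and> x j < x (k + 1))" if j: "1 \<le> j" "j \<le> length L" for j
    proof (cases "j \<le> k")
      case True
      thus ?thesis using less[of j k] j k by (cases "j = k") auto
    next
      case False
      thus ?thesis using less[of "k + 1" j] j k by (cases "j = k + 1") auto
    qed
    thus ?thesis unfolding img[symmetric] by force
  qed
  have "P (x (k - 1)) (x k) (x (k + 1))" if k: "k \<in> {2..<length L}" for k
  proof (rule P)
    show "x (k - 1) \<in> S" "x k \<in> S" "x (k + 1) \<in> S"
      unfolding img[symmetric] using k by (auto intro!: imageI)
    show "x (k - 1) < x k" "x k < x (k + 1)" using k by (auto intro!: less)
    show "S \<inter> {x (k - 1)<..<x k} = {}" "S \<inter> {x k<..<x (k + 1)} = {}"
      using gap[of "k - 1"] gap[of k] k by (simp_all add: le_diff_conv2)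
  qed
  with mono img show ?thesis by blast
qed

lemma convex_zeros_onI:
  fixes u u' Q :: "real \<Rightarrow> real"
  assumes u: "\<And>x. (u has_real_derivative u' x) (at x)"
    and u': "\<And>x. (u' has_real_derivative - (Q x * u x)) (at x)"
    and f: "\<And>x. f x = 0 \<longleftrightarrow> u x = 0" and fin: "finite {x \<in> I. f x = 0}"
    and I: "is_interval I"
    and Q: "\<And>s t. s \<in> I \<Longrightarrow> t \<in> I \<Longrightarrow> s < t \<Longrightarrow> 0 < Q t \<Longrightarrow> Q t < Q s"
  shows "convex_zeros_on I f"
  unfolding convex_zeros_on_def
proof (rule enumerate_with_consecutive_triples[OF fin])
  fix a b c
  assume mem: "a \<in> {x \<in> I. f x = 0}" "b \<in> {x \<in> I. f x = 0}" "c \<in> {x \<in> I. f x = 0}"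
    and ord: "a < b" "b < c"
    and gaps: "{x \<in> I. f x = 0} \<inter> {a<..<b} = {}" "{x \<in> I. f x = 0} \<inter> {b<..<c} = {}"
  have sub: "t \<in> I" if "a \<le> t" "t \<le> c" for t
    using I mem that unfolding is_interval_1 by blast
  show "b - a < c - b"
  proof (rule zero_gaps_increase[OF u u' ord])
    show "u a = 0" "u b = 0" "u c = 0" using mem f by auto
    show "u t \<noteq> 0" if "a < t" "t < b" for t
      using gaps(1) that sub[of t] ord f[of t] by auto
    show "u t \<noteq> 0" if "b < t" "t < c" for t
      using gaps(2) that sub[of t] ord f[of t] by auto
  qed (rule Q; use sub in simp)
qed

lemma concave_zeros_onI:
  fixes u u' Q :: "real \<Rightarrow> real"
  assumes u: "\<And>x. (u has_real_derivative u' x) (at x)"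
    and u': "\<And>x. (u' has_real_derivative - (Q x * u x)) (at x)"
    and f: "\<And>x. f x = 0 \<longleftrightarrow> u x = 0" and fin: "finite {x \<in> I. f x = 0}"
    and I: "is_interval I"
    and Q: "\<And>s t. s \<in> I \<Longrightarrow> t \<in> I \<Longrightarrow> s < t \<Longrightarrow> 0 < Q s \<Longrightarrow> Q s < Q t"
  shows "concave_zeros_on I f"
  unfolding concave_zeros_on_def
proof (rule enumerate_with_consecutive_triples[OF fin])
  fix a b c
  assume mem: "a \<in> {x \<in> I. f x = 0}" "b \<in> {x \<in> I. f x = 0}" "c \<in> {x \<in> I. f x = 0}"
    and ord: "a < b" "b < c"
    and gaps: "{x \<in> I. f x = 0} \<inter> {a<..<b} = {}" "{x \<in> I. f x = 0} \<inter> {b<..<c} = {}"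
  have sub: "t \<in> I" if "a \<le> t" "t \<le> c" for t
    using I mem that unfolding is_interval_1 by blast
  show "c - b < b - a"
  proof (rule zero_gaps_decrease[OF u u' ord])
    show "u a = 0" "u b = 0" "u c = 0" using mem f by auto
    show "u t \<noteq> 0" if "a < t" "t < b" for t
      using gaps(1) that sub[of t] ord f[of t] by auto
    show "u t \<noteq> 0" if "b < t" "t < c" for t
      using gaps(2) that sub[of t] ord f[of t] by auto
  qed (rule Q; use sub in simp)
qed

section \<open>The differential equation of the polynomials\<close>

text \<open>The three-term recurrence, read as one for real polynomials, so that formal derivatives and the
  finiteness of the set of roots become available. The parameter is \<open>b = l + \<i> h\<close>, and the index
  of the recurrence step is \<open>n + 1\<close>.\<close>

fun crr_poly :: "real \<Rightarrow> real \<Rightarrow> nat \<Rightarrow> real poly" where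
  "crr_poly l h 0 = 1"
| "crr_poly l h (Suc 0) = [:- (h / l), 1:]"
| "crr_poly l h (Suc (Suc n)) = [:- (h / (l + real n + 1)), 1:] * crr_poly l h (Suc n)
     - smult ((real n + 1) * (real n + 2 * l) / (4 * ((real n + l) * (real n + 1 + l))))
         ([:1, 0, 1:] * crr_poly l h n)"

lemma poly_crr_poly_rec:
  "poly (crr_poly l h (Suc (Suc n))) x = (x - h / (l + real n + 1)) * poly (crr_poly l h (Suc n)) x
     - (real n + 1) * (real n + 2 * l) / (4 * ((real n + l) * (real n + 1 + l))) * ((1 + x\<^sup>2) *
         poly (crr_poly l h n) x)"
proof -
  have "poly [:- c, 1:] x = x - c" "poly [:1, 0, 1:] x = 1 + x\<^sup>2" for c :: real
    by (simp_all add: power2_eq_square)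
  thus ?thesis by (simp only: crr_poly.simps poly_diff poly_mult poly_smult)
qed

lemma crr_eq_poly:
  assumes "Re b > 0"
  shows "crr b n x = of_real (poly (crr_poly (Re b) (Im b) n) x)"
proof (induction "Re b" "Im b" n rule: crr_poly.induct)
  case 1
  show ?case by (simp add: crr_0)
next
  case 2
  show ?case using crr_1[OF assms, of x] by simp
next
  case (3 n)
  have d: "1 / 4 * (real (n + 1) * (real (n + 1) + 2 * Re b - 1)) /
         ((real (n + 1) + Re b - 1) * (real (n + 1) + Re b)) =
      (real n + 1) * (real n + 2 * Re b) / (4 * ((real n + Re b) * (real n + 1 + Re b)))"
    by (simp add: add_ac)
  have *: "poly (crr_poly (Re b) (Im b) (Suc (Suc n))) x =
    (x - Im b / (Re b + real (n + 1))) * poly (crr_poly (Re b) (Im b) (n + 1)) x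
     - 1 / 4 * (real (n + 1) * (real (n + 1) + 2 * Re b - 1)) /
         ((real (n + 1) + Re b - 1) * (real (n + 1) + Re b)) * (x\<^sup>2 + 1) *
       poly (crr_poly (Re b) (Im b) n) x"
    unfolding d poly_crr_poly_rec by (simp add: add_ac mult_ac)
  show ?case
    unfolding * using crr_rec[OF assms, of "n + 1" x] 3 by simp
qed

text \<open>In terms of the hypergeometric series this is the contiguity relation
  \<open>(n - t d/dt) F(-n, b; c; t) = n F(-(n - 1), b; c; t)\<close>. The induction below needs only the
  recurrence: differentiating it for \<open>n = k + 1\<close> produces the term \<open>(1 + x\<^sup>2) p\<^sub>k'\<close>, which by the
  induction hypothesis is a multiple of \<open>(1 + x\<^sup>2) p\<^sub>j\<close> with \<open>k = j + 1\<close>, and the recurrence one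
  step below expresses that through \<open>p\<^sub>k\<close> and \<open>p\<^sub>n\<close>.\<close>

lemma pderiv_crr_poly:
  assumes l: "l > 0"
  shows "pderiv (crr_poly l h (Suc n)) =
    smult ((real n + 1) * (2 * l + real n) / (2 * (l + real n))) (crr_poly l h n)"
proof (induction n rule: less_induct)
  case (less n)
  show ?case
  proof (cases n)
    case 0
    thus ?thesis using l by (simp add: pderiv_pCons)
  next
    case (Suc k)
    define e where "e = (\<lambda>n. (real n + 1) * (2 * l + real n) / (2 * (l + real n)))"
    define d where "d = (real k + 1) * (real k + 2 * l) / (4 * ((real k + l) * (real k + 1 + l)))"
    define g where "g = (real k + 1) * (real k + 2 * l) / (2 * (real k + 1 + l))"
    let ?p = "\<lambda>n. poly (crr_poly l h n)"
    have nz: "real k + l \<noteq> 0" "real k + 1 + l \<noteq> 0" "l \<noteq> 0" "l + 1 \<noteq> 0" "real k + l + 1 \<noteq> 0"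
      "l + real k \<noteq> 0" "l + real k + 1 \<noteq> 0"
      using l by linarith+
    \<comment> \<open>The factor \<open>g\<close> is \<open>d\<close> times the constant in the derivative of \<open>p\<^sub>k\<close>, divided by the recurrence
      coefficient one step below. After cancellation it makes sense for \<open>k = 0\<close> too, where both sides
      vanish.\<close>
    have low: "d * (1 + x\<^sup>2) * poly (pderiv (crr_poly l h k)) x =
        g * ((x - h / (l + real k)) * ?p k x - ?p (Suc k) x)" for x
    proof (cases k)
      case 0
      thus ?thesis by (simp add: pderiv_1)
    next
      case (Suc j)
      define X where "X = (1 + x\<^sup>2) * ?p j x"
      have nzj: "real j + l \<noteq> 0" "real j + 1 + l \<noteq> 0" "real j + 2 + l \<noteq> 0"
        using l by linarith+
      have c: "d * ((real j + 1) * (2 * l + real j) / (2 * (l + real j))) =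
         g * ((real j + 1) * (real j + 2 * l) / (4 * ((real j + l) * (real j + 1 + l))))"
        using nzj unfolding d_def g_def Suc by (simp add: divide_simps) (simp add: algebra_simps)
      have "d * (1 + x\<^sup>2) * poly (pderiv (crr_poly l h k)) x =
          (d * ((real j + 1) * (2 * l + real j) / (2 * (l + real j)))) * X"
        using less.IH[of j] \<open>n = Suc k\<close> Suc by (simp add: X_def)
      also have "\<dots> = g * ((real j + 1) * (real j + 2 * l) / (4 * ((real j + l) * (real j + 1 + l))) * X)"
        unfolding c by simp
      also have "\<dots> = g * ((x - h / (l + real k)) * ?p k x - ?p (Suc k) x)"
        unfolding Suc X_def poly_crr_poly_rec by (simp add: add_ac)
      finally show ?thesis .
    qed
    have IH: "poly (pderiv (crr_poly l h (Suc k))) x = e k * ?p k x" for x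
      using less.IH[of k] Suc by (simp add: e_def)
    have e1: "1 + g = e n" and ek: "e k - 2 * d - g = 0"
      and eg: "e k * (h / (l + real k + 1)) = g * (h / (l + real k))"
      using nz unfolding d_def g_def e_def Suc
      by (simp_all add: divide_simps) (simp_all add: algebra_simps)
    have "poly (pderiv (crr_poly l h (Suc n))) x = poly (smult (e n) (crr_poly l h n)) x" for x
    proof -
      have "poly (pderiv (crr_poly l h (Suc n))) x =
          ?p (Suc k) x + (x - h / (l + real k + 1)) * (e k * ?p k x)
          - d * (2 * x) * ?p k x - d * (1 + x\<^sup>2) * poly (pderiv (crr_poly l h k)) x"
      proof -
        have lin: "poly [:- c, 1:] x = x - c" "poly (pderiv [:- c, 1:]) x = 1"
          "poly [:1, 0, 1:] x = 1 + x\<^sup>2" "poly (pderiv [:1, 0, 1:]) x = 2 * x" for c :: real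
          by (simp_all add: power2_eq_square pderiv_pCons)
        show ?thesis
          unfolding Suc crr_poly.simps(3) d_def[symmetric]
          by (simp only: pderiv_diff pderiv_mult pderiv_smult poly_diff poly_add poly_mult
              poly_smult lin IH) (simp add: algebra_simps)
      qed
      also have "\<dots> = (1 + g) * ?p (Suc k) x + (x * (e k - 2 * d - g)
          - (e k * (h / (l + real k + 1)) - g * (h / (l + real k)))) * ?p k x"
        unfolding low by (simp add: algebra_simps)
      also have "\<dots> = e n * ?p n x" unfolding ek eg e1 Suc by simp
      finally show ?thesis by simp
    qed
    thus ?thesis unfolding e_def by (intro iffD1[OF poly_eq_poly_eq_iff] ext)
  qed
qed

text \<open>If a polynomial of the sequence vanished, so would its derivative, and with it all the earlier
  ones down to the constant \<open>1\<close>. This avoids computing leading coefficients.\<close>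

lemma crr_poly_nonzero:
  assumes "l > 0"
  shows "crr_poly l h n \<noteq> 0"
proof (induction n)
  case (Suc n)
  show ?case
  proof
    assume "crr_poly l h (Suc n) = 0"
    thus False using pderiv_crr_poly[OF assms, of h n] Suc assms
      by (auto simp: pderiv_0 add_nonneg_eq_0_iff)
  qed
qed simp

text \<open>For \<open>n \<ge> 2\<close> this is the recurrence itself, with the two earlier polynomials replaced by multiples
  of the first and second derivatives.\<close>

lemma crr_poly_ode:
  fixes l h x :: real and n :: nat
  assumes l: "l > 0"
  defines "p \<equiv> crr_poly l h n"
  shows "(1 + x\<^sup>2) * poly (pderiv (pderiv p)) x =
    2 * ((real n + l - 1) * x - h) * poly (pderiv p) x - real n * (real n + 2 * l - 1) * poly p x"
proof -
  consider "n = 0" | "n = 1" | k where "n = Suc (Suc k)"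
    by (metis One_nat_def not0_implies_Suc)
  thus ?thesis
  proof cases
    case 1
    thus ?thesis by (simp add: p_def pderiv_1)
  next
    case 2
    thus ?thesis using l by (simp add: p_def pderiv_pCons pderiv_1 field_simps)
  next
    case (3 k)
    have nz: "real k + l \<noteq> 0" "real k + l + 1 \<noteq> 0" "l + real k \<noteq> 0" "real k + 1 + l \<noteq> 0"
      "l + real k + 1 \<noteq> 0"
      using l by linarith+
    define y z where "y = poly (crr_poly l h (Suc k)) x" and "z = (1 + x\<^sup>2) * poly (crr_poly l h k) x"
    have p: "poly p x = (x - h / (l + real k + 1)) * y
        - (real k + 1) * (real k + 2 * l) / (4 * ((real k + l) * (real k + 1 + l))) * z"
      unfolding p_def 3 poly_crr_poly_rec y_def z_def by simp
    have p': "poly (pderiv p) x = (real k + 2) * (2 * l + real k + 1) / (2 * (l + real k + 1)) * y"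
      unfolding p_def 3 pderiv_crr_poly[OF l] y_def by (simp add: add_ac)
    have p'': "(1 + x\<^sup>2) * poly (pderiv (pderiv p)) x =
       (real k + 2) * (2 * l + real k + 1) / (2 * (l + real k + 1)) *
       ((real k + 1) * (2 * l + real k) / (2 * (l + real k))) * z"
      unfolding p_def 3 pderiv_crr_poly[OF l] pderiv_smult z_def by (simp add: add_ac)
    show ?thesis
      unfolding p'' unfolding p p' 3 using nz
      by (simp add: divide_simps) (simp add: algebra_simps)
  qed
qed

text \<open>The Liouville normal form of \<open>y'' + P y' + R y = 0\<close> has the potential \<open>R - P' / 2 - P\<^sup>2 / 4\<close>. Here
  it has the denominator \<open>(1 + x\<^sup>2)\<^sup>2\<close>, and the numerator is only quadratic.\<close>

definition crr_potential_num :: "real \<Rightarrow> real \<Rightarrow> nat \<Rightarrow> real \<Rightarrow> real" where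
  "crr_potential_num l h n x = - (l * (l - 1)) * x\<^sup>2 + 2 * (h * (real n + l)) * x
     + ((real n)\<^sup>2 + 2 * real n * l + l - 1 - h\<^sup>2)"

definition crr_potential :: "real \<Rightarrow> real \<Rightarrow> nat \<Rightarrow> real \<Rightarrow> real" where
  "crr_potential l h n x = crr_potential_num l h n x / (1 + x\<^sup>2)\<^sup>2"

text \<open>The weight is \<open>exp (\<integral> P / 2)\<close>, where \<open>P\<close> is the coefficient of the first derivative; it is
  nowhere zero.\<close>

lemma crr_liouville_form:
  assumes l: "l > 0"
  obtains u u' :: "real \<Rightarrow> real" where
    "\<And>x. (u has_real_derivative u' x) (at x)"
    "\<And>x. (u' has_real_derivative - (crr_potential l h n x * u x)) (at x)"
    "\<And>x. u x = 0 \<longleftrightarrow> poly (crr_poly l h n) x = 0"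
proof -
  define N where "N = real n + l - 1"
  define p where "p = crr_poly l h n"
  define w where "w = (\<lambda>x. exp (h * arctan x - N / 2 * ln (1 + x\<^sup>2)))"
  \<comment> \<open>The logarithmic derivative of the weight.\<close>
  define r where "r = (\<lambda>x. (h - N * x) / (1 + x\<^sup>2))"
  define u where "u = (\<lambda>x. poly p x * w x)"
  define u' where "u' = (\<lambda>x. (poly (pderiv p) x + r x * poly p x) * w x)"
  have s: "1 + x\<^sup>2 > 0" for x :: real by (simp add: add_pos_nonneg)
  have s': "1 + x\<^sup>2 \<noteq> 0" for x :: real using s[of x] by linarith
  have Dw: "(w has_real_derivative r x * w x) (at x)" for x
  proof -
    have "((\<lambda>x. 1 + x\<^sup>2) has_real_derivative 2 * x) (at x)"
      by (auto intro!: derivative_eq_intros)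
    from DERIV_diff[OF DERIV_cmult[OF DERIV_arctan]
        DERIV_cmult[OF DERIV_chain2[OF DERIV_ln[OF s] this]], of h "N / 2"]
    have "((\<lambda>x. h * arctan x - N / 2 * ln (1 + x\<^sup>2)) has_real_derivative r x) (at x)"
      by (simp add: r_def diff_divide_distrib inverse_eq_divide)
    from DERIV_chain2[OF DERIV_exp this] show ?thesis by (simp add: w_def mult.commute)
  qed
  define r' where "r' = (\<lambda>x. (- N * (1 + x\<^sup>2) - (h - N * x) * (2 * x)) / (1 + x\<^sup>2)\<^sup>2)"
  have Dr: "(r has_real_derivative r' x) (at x)" for x
    unfolding r_def r'_def
    by (rule derivative_eq_intros refl s')+ (simp add: power2_eq_square)
  have 1: "(u has_real_derivative u' x) (at x)" for x
    unfolding u_def u'_def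
    by (rule derivative_eq_intros poly_DERIV Dw refl)+ (simp add: algebra_simps)
  have 2: "(u' has_real_derivative - (crr_potential l h n x * u x)) (at x)" for x
  proof -
    have D: "(u' has_real_derivative (poly (pderiv (pderiv p)) x + 2 * r x * poly (pderiv p) x
        + (r' x + (r x)\<^sup>2) * poly p x) * w x) (at x)"
      unfolding u'_def
      by (rule derivative_eq_intros poly_DERIV Dw Dr refl)+ (simp add: algebra_simps power2_eq_square)
    define S where "S = 1 + x\<^sup>2"
    have S: "S \<noteq> 0" using s' by (simp add: S_def)
    have ode: "poly (pderiv (pderiv p)) x =
        (2 * (N * x - h) * poly (pderiv p) x - real n * (real n + 2 * l - 1) * poly p x) / S"
      using crr_poly_ode[OF l, of x h n] S unfolding p_def N_def S_def by (simp add: field_simps)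
    have r: "2 * r x * poly (pderiv p) x = - (2 * (N * x - h) * poly (pderiv p) x) / S"
      unfolding r_def S_def[symmetric] by (simp add: divide_simps) (simp add: algebra_simps)
    have num: "- real n * (real n + 2 * l - 1) * S + (- N * S - (h - N * x) * (2 * x)) + (h - N * x)\<^sup>2
        = - crr_potential_num l h n x"
      unfolding S_def N_def crr_potential_num_def by (simp add: algebra_simps power2_eq_square)
    have "- (real n * (real n + 2 * l - 1)) / S + r' x + (r x)\<^sup>2 =
        (- real n * (real n + 2 * l - 1) * S + (- N * S - (h - N * x) * (2 * x)) + (h - N * x)\<^sup>2) / S\<^sup>2"
    proof -
      have "- (real n * (real n + 2 * l - 1)) / S = - real n * (real n + 2 * l - 1) * S / S\<^sup>2"
        using S by (simp add: power2_eq_square)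
      thus ?thesis
        unfolding r_def r'_def S_def[symmetric] by (simp only: add_divide_distrib power_divide)
    qed
    hence q: "- (real n * (real n + 2 * l - 1)) / S + r' x + (r x)\<^sup>2 = - crr_potential l h n x"
      unfolding num crr_potential_def S_def[symmetric] by simp
    have "poly (pderiv (pderiv p)) x + 2 * r x * poly (pderiv p) x + (r' x + (r x)\<^sup>2) * poly p x
        = (- (real n * (real n + 2 * l - 1)) / S + r' x + (r x)\<^sup>2) * poly p x"
      unfolding ode r by (simp add: algebra_simps diff_divide_distrib add_divide_distrib)
    also have "\<dots> = - crr_potential l h n x * poly p x" unfolding q ..
    finally show ?thesis using D by (simp add: u_def mult_ac)
  qed
  have 3: "u x = 0 \<longleftrightarrow> poly (crr_poly l h n) x = 0" for x
    by (simp add: u_def w_def p_def)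
  show ?thesis by (rule that[OF 1 2 3])
qed

section \<open>Monotonicity of the potential and the spacing of the zeros\<close>

lemma crr_potential_less:
  assumes "0 < crr_potential l h n t"
    and "crr_potential_num l h n t \<le> crr_potential_num l h n s" and "\<bar>s\<bar> < \<bar>t\<bar>"
  shows "crr_potential l h n t < crr_potential l h n s"
proof -
  have pos: "1 + x\<^sup>2 > 0" for x :: real by (simp add: add_pos_nonneg)
  have num: "0 < crr_potential_num l h n t"
    using assms(1) pos[of t] by (simp add: crr_potential_def zero_less_divide_iff)
  have "s\<^sup>2 < t\<^sup>2" using assms(3) by (simp add: abs_le_square_iff flip: not_le)
  hence "(1 + s\<^sup>2)\<^sup>2 < (1 + t\<^sup>2)\<^sup>2" using pos[of s] by (intro power_strict_mono) auto
  thus ?thesis unfolding crr_potential_def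
    using num assms(2) pos[of s] by (intro frac_less2) auto
qed

lemma finite_crr_zeros:
  assumes "Re b > 0"
  shows "finite {x \<in> I. crr b n (x + M) = 0}"
proof -
  have "finite ((\<lambda>x. x - M) ` {y. poly (crr_poly (Re b) (Im b) n) y = 0})"
    using poly_roots_finite[OF crr_poly_nonzero[OF assms]] by simp
  moreover have "{x \<in> I. crr b n (x + M) = 0} \<subseteq>
      (\<lambda>x. x - M) ` {y. poly (crr_poly (Re b) (Im b) n) y = 0}"
    by (force simp: crr_eq_poly[OF assms])
  ultimately show ?thesis by (rule rev_finite_subset)
qed

lemma crr_convex_zeros:
  assumes b: "Re b > 0" and I: "is_interval I"
    and num: "\<And>s t. s \<in> I \<Longrightarrow> t \<in> I \<Longrightarrow> s < t \<Longrightarrow>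
      crr_potential_num (Re b) (Im b) n (t + M) \<le> crr_potential_num (Re b) (Im b) n (s + M)"
    and outward: "\<And>s t. s \<in> I \<Longrightarrow> t \<in> I \<Longrightarrow> s < t \<Longrightarrow> \<bar>s + M\<bar> < \<bar>t + M\<bar>"
  shows "convex_zeros_on I (\<lambda>x. crr b n (x + M))"
proof -
  obtain u u' where u: "\<And>x. (u has_real_derivative u' x) (at x)"
    "\<And>x. (u' has_real_derivative - (crr_potential (Re b) (Im b) n x * u x)) (at x)"
    "\<And>x. u x = 0 \<longleftrightarrow> poly (crr_poly (Re b) (Im b) n) x = 0"
    using crr_liouville_form[OF b, of "Im b" n] by blast
  show ?thesis
  proof (rule convex_zeros_onI[where u = "\<lambda>x. u (x + M)" and u' = "\<lambda>x. u' (x + M)"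
        and Q = "\<lambda>x. crr_potential (Re b) (Im b) n (x + M)"])
    show "((\<lambda>x. u (x + M)) has_real_derivative u' (x + M)) (at x)"
      "((\<lambda>x. u' (x + M)) has_real_derivative
         - (crr_potential (Re b) (Im b) n (x + M) * u (x + M))) (at x)" for x
      using u(1,2)[of "x + M"] by (simp_all add: DERIV_shift)
  qed (use u(3) I num outward in
        \<open>auto simp: crr_eq_poly[OF b] intro!: crr_potential_less
           finite_crr_zeros[OF b, unfolded crr_eq_poly[OF b] of_real_eq_0_iff]\<close>)
qed

lemma crr_concave_zeros:
  assumes b: "Re b > 0" and I: "is_interval I"
    and num: "\<And>s t. s \<in> I \<Longrightarrow> t \<in> I \<Longrightarrow> s < t \<Longrightarrow>
      crr_potential_num (Re b) (Im b) n (s + M) \<le> crr_potential_num (Re b) (Im b) n (t + M)"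
    and inward: "\<And>s t. s \<in> I \<Longrightarrow> t \<in> I \<Longrightarrow> s < t \<Longrightarrow> \<bar>t + M\<bar> < \<bar>s + M\<bar>"
  shows "concave_zeros_on I (\<lambda>x. crr b n (x + M))"
proof -
  obtain u u' where u: "\<And>x. (u has_real_derivative u' x) (at x)"
    "\<And>x. (u' has_real_derivative - (crr_potential (Re b) (Im b) n x * u x)) (at x)"
    "\<And>x. u x = 0 \<longleftrightarrow> poly (crr_poly (Re b) (Im b) n) x = 0"
    using crr_liouville_form[OF b, of "Im b" n] by blast
  show ?thesis
  proof (rule concave_zeros_onI[where u = "\<lambda>x. u (x + M)" and u' = "\<lambda>x. u' (x + M)"
        and Q = "\<lambda>x. crr_potential (Re b) (Im b) n (x + M)"])
    show "((\<lambda>x. u (x + M)) has_real_derivative u' (x + M)) (at x)"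
      "((\<lambda>x. u' (x + M)) has_real_derivative
         - (crr_potential (Re b) (Im b) n (x + M) * u (x + M))) (at x)" for x
      using u(1,2)[of "x + M"] by (simp_all add: DERIV_shift)
  qed (use u(3) I num inward in
        \<open>auto simp: crr_eq_poly[OF b] intro!: crr_potential_less
           finite_crr_zeros[OF b, unfolded crr_eq_poly[OF b] of_real_eq_0_iff]\<close>)
qed

lemma crr_potential_num_diff:
  "crr_potential_num l h n t - crr_potential_num l h n s =
     (t - s) * (2 * (h * (real n + l)) - l * (l - 1) * (s + t))"
  by (simp add: crr_potential_num_def algebra_simps power2_eq_square)

text \<open>The numerator is symmetric about its vertex \<open>crr_shift b n\<close>; this form of the difference shows its
  sign on either side of the vertex.\<close>

lemma crr_potential_num_diff_vertex:
  assumes "Re b \<noteq> 0" "Re b \<noteq> 1"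
  shows "crr_potential_num (Re b) (Im b) n t - crr_potential_num (Re b) (Im b) n s =
     Re b * (Re b - 1) * ((t - s) * ((crr_shift b n - s) + (crr_shift b n - t)))"
proof -
  have "Re b * (Re b - 1) * crr_shift b n = Im b * (real n + Re b)"
    using assms by (simp add: crr_shift_def)
  thus ?thesis
    unfolding crr_potential_num_diff by algebra
qed

theorem theorem3p2:
  fixes lam \<eta> :: real and b :: complex and n :: nat
  assumes "lam > 0" and "b = Complex lam \<eta>"
  shows
   "(lam > 1 \<longrightarrow>
       (\<eta> = 0 \<longrightarrow> concave_zeros_on {..<0} (crr b n) \<and> convex_zeros_on {0<..} (crr b n)) \<and>
       (\<eta> > 0 \<longrightarrow> concave_zeros_on {..<0} (crr b n) \<and>
                 convex_zeros_on {0<..} (\<lambda>x. crr b n (x + crr_shift b n))) \<and>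
       (\<eta> < 0 \<longrightarrow> concave_zeros_on {..<0} (\<lambda>x. crr b n (x + crr_shift b n)) \<and>
                 convex_zeros_on {0<..} (crr b n))) \<and>
    (lam < 1 \<longrightarrow>
       (\<eta> > 0 \<longrightarrow> concave_zeros_on {crr_shift b n<..<0} (crr b n)) \<and>
       (\<eta> < 0 \<longrightarrow> convex_zeros_on {0<..<crr_shift b n} (crr b n))) \<and>
    (lam = 1 \<longrightarrow>
       (\<eta> > 0 \<longrightarrow> concave_zeros_on {..<0} (crr b n)) \<and>
       (\<eta> < 0 \<longrightarrow> convex_zeros_on {0<..} (crr b n)))"
proof -
  have b: "Re b = lam" "Im b = \<eta>" "Re b > 0" using assms by simp_all
  define M where "M = crr_shift b n"
  have convex: "convex_zeros_on I (\<lambda>x. crr b n (x + m))"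
    if "is_interval I"
      "\<And>s t. s \<in> I \<Longrightarrow> t \<in> I \<Longrightarrow> s < t \<Longrightarrow>
         crr_potential_num lam \<eta> n (t + m) - crr_potential_num lam \<eta> n (s + m) \<le> 0"
      "\<And>s. s \<in> I \<Longrightarrow> 0 < s + m" for I m
    by (rule crr_convex_zeros[OF b(3) that(1)]) (use that(2,3) b in force)+
  have concave: "concave_zeros_on I (\<lambda>x. crr b n (x + m))"
    if "is_interval I"
      "\<And>s t. s \<in> I \<Longrightarrow> t \<in> I \<Longrightarrow> s < t \<Longrightarrow>
         0 \<le> crr_potential_num lam \<eta> n (t + m) - crr_potential_num lam \<eta> n (s + m)"
      "\<And>s. s \<in> I \<Longrightarrow> s + m < 0" for I m
    by (rule crr_concave_zeros[OF b(3) that(1)]) (use that(2,3) b in force)+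
  note convex0 = convex[of _ 0, simplified] and concave0 = concave[of _ 0, simplified]
  consider "lam > 1" | "lam < 1" | "lam = 1" by linarith
  thus ?thesis
  proof cases
    case 1
    \<comment> \<open>The parabola opens downwards, and its vertex has the sign of \<open>\<eta>\<close>.\<close>
    have a: "lam * (lam - 1) > 0" using 1 by simp
    have sgnM: "\<eta> \<ge> 0 \<Longrightarrow> M \<ge> 0" "\<eta> \<le> 0 \<Longrightarrow> M \<le> 0"
      using 1 by (auto simp: M_def crr_shift_def b intro!: divide_nonneg_nonneg
          divide_nonpos_nonneg mult_nonneg_nonneg mult_nonpos_nonneg)
    have num: "crr_potential_num lam \<eta> n t - crr_potential_num lam \<eta> n s =
        lam * (lam - 1) * ((t - s) * ((M - s) + (M - t)))" for s t
      using crr_potential_num_diff_vertex[of b n t s] 1 unfolding b M_def by simp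
    have inc: "0 \<le> crr_potential_num lam \<eta> n t - crr_potential_num lam \<eta> n s"
      if "s < t" "t \<le> M" for s t
      unfolding num using a that by (intro mult_nonneg_nonneg[OF less_imp_le[OF a]] mult_nonneg_nonneg) auto
    have dec: "crr_potential_num lam \<eta> n t - crr_potential_num lam \<eta> n s \<le> 0"
      if "s < t" "M \<le> s" for s t
      unfolding num using a that by (intro mult_nonneg_nonpos[OF less_imp_le[OF a]] mult_nonneg_nonpos) auto
    have "concave_zeros_on {..<0} (crr b n)" if "\<eta> \<ge> 0"
      using sgnM that by (intro concave0) (auto simp: is_interval_1 intro!: inc[simplified])
    moreover have "convex_zeros_on {0<..} (crr b n)" if "\<eta> \<le> 0"
      using sgnM that by (intro convex0) (auto simp: is_interval_1 intro!: dec[simplified])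
    moreover have "convex_zeros_on {0<..} (\<lambda>x. crr b n (x + M))" if "\<eta> \<ge> 0"
      using sgnM that by (intro convex dec) (auto simp: is_interval_1)
    moreover have "concave_zeros_on {..<0} (\<lambda>x. crr b n (x + M))" if "\<eta> \<le> 0"
      using sgnM that by (intro concave inc) (auto simp: is_interval_1)
    ultimately show ?thesis using 1 by (simp add: M_def)
  next
    case 2
    \<comment> \<open>The parabola opens upwards: it increases to the right of its vertex.\<close>
    have a: "lam * (lam - 1) \<le> 0" using 2 assms by (simp add: mult_le_0_iff)
    have num: "crr_potential_num lam \<eta> n t - crr_potential_num lam \<eta> n s =
        lam * (lam - 1) * ((t - s) * ((M - s) + (M - t)))" for s t
      using crr_potential_num_diff_vertex[of b n t s] 2 assms(1) unfolding b M_def by simp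
    have inc: "0 \<le> crr_potential_num lam \<eta> n t - crr_potential_num lam \<eta> n s"
      if "s < t" "M \<le> s" for s t
      unfolding num using a that by (intro mult_nonpos_nonpos[OF a] mult_nonneg_nonpos) auto
    have dec: "crr_potential_num lam \<eta> n t - crr_potential_num lam \<eta> n s \<le> 0"
      if "s < t" "t \<le> M" for s t
      unfolding num using a that by (intro mult_nonpos_nonneg[OF a] mult_nonneg_nonneg) auto
    have "concave_zeros_on {M<..<0} (crr b n)"
      by (intro concave0) (auto simp: is_interval_1 intro!: inc[simplified])
    moreover have "convex_zeros_on {0<..<M} (crr b n)"
      by (intro convex0) (auto simp: is_interval_1 intro!: dec[simplified])
    ultimately show ?thesis using 2 by (simp add: M_def)
  next
    case 3
    have num: "crr_potential_num lam \<eta> n t - crr_potential_num lam \<eta> n s =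
        (t - s) * (2 * (\<eta> * (real n + 1)))" for s t
      unfolding crr_potential_num_diff 3 by simp
    have inc: "0 \<le> crr_potential_num lam \<eta> n t - crr_potential_num lam \<eta> n s"
      if "s < t" "\<eta> > 0" for s t
      unfolding num using that by simp
    have dec: "crr_potential_num lam \<eta> n t - crr_potential_num lam \<eta> n s \<le> 0"
      if "s < t" "\<eta> < 0" for s t
      unfolding num using that by (intro mult_nonneg_nonpos[of "t - s"]) (auto simp: mult_le_0_iff)
    have "concave_zeros_on {..<0} (crr b n)" if "\<eta> > 0"
      using that by (intro concave0) (auto simp: is_interval_1 intro!: inc[simplified])
    moreover have "convex_zeros_on {0<..} (crr b n)" if "\<eta> < 0"
      using that by (intro convex0) (auto simp: is_interval_1 intro!: dec[simplified])
    ultimately show ?thesis using 3 by simp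
  qed
qed

end
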